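(* Let $\gamma>1$, let $$K_\gamma=\{(\rho,u,m)\in\mathbb{R}\times\mathbb{R}^2\times\mathbb{R}^2:\ |\rho|=1,\ m=\tfrac12\rho u,\ |u|\le\gamma\},$$ and let $\Lambda=\{(\rho,u,m)\in\mathbb{R}\times\mathbb{R}^2\times\mathbb{R}^2:\ |\rho|^2=|u|^2\}$. Then the $\Lambda$-convex hull $(K_\gamma)^\Lambda$ is the set of all $(\rho,u,m)\in\mathbb{R}\times\mathbb{R}^2\times\mathbb{R}^2$ satisfying all of the inequalities \begin{align*} |\rho|&\le 1,\\ |u|^2&\le\gamma^2-(1-\rho^2),\\ |m-\tfrac12\rho u|&\le\tfrac12(1-\rho^2),\\ |m-\tfrac12u|&\le\tfrac{\gamma}{2}(1-\rho),\\ |m+\tfrac12u|&\le\tfrac{\gamma}{2}(1+\rho). \end{align*}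
   Context: A function $f:\mathbb{R}\times\mathbb{R}^2\times\mathbb{R}^2\to\mathbb{R}$ is $\Lambda$-convex if $s\mapsto f(w_0+sw)$ is convex on $\mathbb{R}$ for all $w_0\in\mathbb{R}\times\mathbb{R}^2\times\mathbb{R}^2$ and all $w\in\Lambda$. For a closed set $K\subset\mathbb{R}\times\mathbb{R}^2\times\mathbb{R}^2$, the $\Lambda$-convex hull $K^\Lambda$ is defined by: $z\notin K^\Lambda$ if and only if there exists a $\Lambda$-convex function $f$ with $f\le0$ on $K$ and $f(z)>0$. *)

theory Defs
  imports "HOL-Analysis.Analysis"
begin

type_synonym state = "real \<times> (real ^ 2) \<times> (real ^ 2)"

definition Lambda_convex :: "'a::real_vector set \<Rightarrow> ('a \<Rightarrow> real) \<Rightarrow> bool" where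
  "Lambda_convex \<Lambda> f \<longleftrightarrow>
     (\<forall>w0. \<forall>w\<in>\<Lambda>. convex_on UNIV (\<lambda>s::real. f (w0 + s *\<^sub>R w)))"

text \<open>The hull is normally taken of closed sets only; closedness of \<open>K\<close> plays no role
  in the defining formula.\<close>

definition Lambda_hull :: "'a::real_vector set \<Rightarrow> 'a set \<Rightarrow> 'a set" where
  "Lambda_hull \<Lambda> K =
     {z. \<not> (\<exists>f. Lambda_convex \<Lambda> f \<and> (\<forall>w\<in>K. f w \<le> 0) \<and> f z > 0)}"

definition wave_cone :: "state set" where
  "wave_cone = {(\<rho>, u, m). \<bar>\<rho>\<bar>\<^sup>2 = (norm u)\<^sup>2}"

definition K_set :: "real \<Rightarrow> state set" where
  "K_set \<gamma> = {(\<rho>, u, m). \<bar>\<rho>\<bar> = 1 \<and> m = (1/2 * \<rho>) *\<^sub>R u \<and> norm u \<le> \<gamma>}"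

end

theory Submission
  imports Defs
begin

text \<open>
  Two coordinates make the right-hand side transparent. Every state with
  \<open>\<bar>\<rho>\<bar> < 1\<close> is, in exactly one way, the convex combination with weights \<open>\<theta> = (1 + \<rho>)/2\<close>
  and \<open>1 - \<theta>\<close> of a state \<open>(1, a, a/2)\<close> and a state \<open>(-1, b, -b/2)\<close>. In terms of \<open>(\<theta>, a, b)\<close>
  the last three inequalities say \<open>\<bar>a - b\<bar> \<le> 2\<close>, \<open>\<bar>b\<bar> \<le> \<gamma>\<close> and \<open>\<bar>a\<bar> \<le> \<gamma>\<close>; and the two states
  being combined differ by an element of the wave cone exactly when \<open>\<bar>a - b\<bar> = 2\<close>.

  The inequalities hold on the hull because each is a condition \<open>f \<le> 0\<close>, or a family of such
  conditions, with \<open>f\<close> convex along the wave cone. For the second and third the functions \<open>f\<close> are not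
  convex in all directions, but the quadratic part \<open>\<bar>u\<bar>\<^sup>2 - \<rho>\<^sup>2\<close> of the second vanishes on the
  cone, and the quadratic part \<open>(\<rho>\<^sup>2 - \<rho> (u \<bullet> e))/2\<close> of the third, tested against a unit vector \<open>e\<close>, is nonnegative there.

  Conversely, every state satisfying the inequalities is reached from \<open>K_set \<gamma>\<close> by three rounds of
  adding segments in wave cone directions. First, \<open>\<bar>a - b\<bar> = 2\<close> gives a single segment between two
  points of \<open>K_set \<gamma>\<close>. Second, if \<open>\<bar>a\<bar> = \<gamma>\<close>, then \<open>a\<close> is kept fixed while \<open>b\<close> moves along a chord
  of the circle of radius 2 about \<open>a\<close>: in one direction the state reaches \<open>\<rho> = -1\<close>, in the other
  it reaches \<open>\<bar>a - b\<bar> = 2\<close>. The work lies in choosing the chord so that both ends keep within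
  \<open>\<gamma>\<close> (\<open>chord_in_hull\<close>, \<open>outer_boundary_in_hull\<close>). The case \<open>\<bar>b\<bar> = \<gamma>\<close> is its mirror image.
  Third, \<open>m\<close> may be moved in any direction with \<open>\<rho>\<close> and \<open>u\<close> fixed, so that every remaining state
  lies between two states for which one of the last three inequalities is an equality.
\<close>

section \<open>Hulls with respect to a cone of directions\<close>

lemma subset_Lambda_hull: "K \<subseteq> Lambda_hull \<Lambda> K"
  unfolding Lambda_hull_def by force

lemma Lambda_hullD:
  assumes "z \<in> Lambda_hull \<Lambda> K" "Lambda_convex \<Lambda> f" "\<And>w. w \<in> K \<Longrightarrow> f w \<le> 0"
  shows "f z \<le> 0"
  using assms unfolding Lambda_hull_def by force

lemma Lambda_hull_segment:
  assumes x: "x \<in> Lambda_hull \<Lambda> K" and y: "y \<in> Lambda_hull \<Lambda> K"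
    and dir: "y - x \<in> \<Lambda>" and z: "z \<in> closed_segment x y"
  shows "z \<in> Lambda_hull \<Lambda> K"
proof -
  obtain t where t: "0 \<le> t" "t \<le> 1" "z = (1 - t) *\<^sub>R x + t *\<^sub>R y"
    using z unfolding closed_segment_def by auto
  have zt: "z = x + t *\<^sub>R (y - x)"
    using t(3) by (simp add: algebra_simps)
  have "f z \<le> 0" if f: "Lambda_convex \<Lambda> f" "\<forall>w\<in>K. f w \<le> 0" for f
  proof -
    have "convex_on UNIV (\<lambda>s::real. f (x + s *\<^sub>R (y - x)))"
      using f(1) dir unfolding Lambda_convex_def by blast
    from convex_onD[OF this t(1,2), of 0 1]
    have "f z \<le> (1 - t) * f x + t * f y"
      using zt by simp
    moreover have "f x \<le> 0" "f y \<le> 0"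
      using Lambda_hullD[OF x f(1)] Lambda_hullD[OF y f(1)] f(2) by auto
    ultimately show ?thesis
      using t(1,2) mult_nonneg_nonpos[of "1 - t" "f x"] mult_nonneg_nonpos[of t "f y"] by linarith
  qed
  then show ?thesis unfolding Lambda_hull_def by force
qed

lemma Lambda_hull_linear_image:
  assumes lin: "linear g" and cone: "g ` \<Lambda> \<subseteq> \<Lambda>'" and K: "g ` K \<subseteq> K'"
    and z: "z \<in> Lambda_hull \<Lambda> K"
  shows "g z \<in> Lambda_hull \<Lambda>' K'"
proof -
  have "f (g z) \<le> 0" if f: "Lambda_convex \<Lambda>' f" "\<forall>w\<in>K'. f w \<le> 0" for f
  proof -
    have "Lambda_convex \<Lambda> (f \<circ> g)"
      using f(1) cone unfolding Lambda_convex_def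
      by (auto simp: linear_add[OF lin] linear_scale[OF lin] image_subset_iff)
    from Lambda_hullD[OF z this] show ?thesis
      using f(2) K by auto
  qed
  then show ?thesis unfolding Lambda_hull_def by force
qed

lemma convex_imp_Lambda_convex:
  assumes "convex_on UNIV f"
  shows "Lambda_convex \<Lambda> f"
  unfolding Lambda_convex_def
proof (intro allI ballI)
  fix w0 w :: 'a assume "w \<in> \<Lambda>"
  show "convex_on UNIV (\<lambda>s::real. f (w0 + s *\<^sub>R w))"
  proof (rule convex_onI)
    fix t x y :: real assume t: "0 < t" "t < 1"
    have eq: "w0 + ((1 - t) *\<^sub>R x + t *\<^sub>R y) *\<^sub>R w
      = (1 - t) *\<^sub>R (w0 + x *\<^sub>R w) + t *\<^sub>R (w0 + y *\<^sub>R w)"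
      by (simp add: algebra_simps)
    show "f (w0 + ((1 - t) *\<^sub>R x + t *\<^sub>R y) *\<^sub>R w)
      \<le> (1 - t) * f (w0 + x *\<^sub>R w) + t * f (w0 + y *\<^sub>R w)"
      unfolding eq using convex_onD[OF assms, of t] t by simp
  qed simp
qed

lemma convex_on_quadratic:
  fixes A B C :: real
  assumes "0 \<le> A"
  shows "convex_on UNIV (\<lambda>s. A * s\<^sup>2 + B * s + C)"
proof (rule convex_onI)
  fix t x y :: real assume t: "0 < t" "t < 1"
  have "(1 - t) * (A * x\<^sup>2 + B * x + C) + t * (A * y\<^sup>2 + B * y + C)
      - (A * ((1 - t) * x + t * y)\<^sup>2 + B * ((1 - t) * x + t * y) + C)
      = A * (t * (1 - t) * (x - y)\<^sup>2)"
    by algebra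
  moreover have "0 \<le> A * (t * (1 - t) * (x - y)\<^sup>2)"
    using assms t by simp
  ultimately show "A * ((1 - t) *\<^sub>R x + t *\<^sub>R y)\<^sup>2 + B * ((1 - t) *\<^sub>R x + t *\<^sub>R y) + C
      \<le> (1 - t) * (A * x\<^sup>2 + B * x + C) + t * (A * y\<^sup>2 + B * y + C)"
    by simp
qed simp

section \<open>The inequalities hold on the hull\<close>

lemma K_setE:
  assumes "w \<in> K_set \<gamma>"
  obtains \<rho> u where "w = (\<rho>, u, (1/2 * \<rho>) *\<^sub>R u)" "\<bar>\<rho>\<bar> = 1" "norm u \<le> \<gamma>"
  using assms unfolding K_set_def by blast

lemma Lambda_convex_norm_sq_diff:
  "Lambda_convex wave_cone (\<lambda>(\<rho>, u, m). (norm u)\<^sup>2 - \<rho>\<^sup>2 - c)"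
  unfolding Lambda_convex_def
proof (intro allI ballI)
  fix w0 w :: state assume w: "w \<in> wave_cone"
  obtain \<rho>0 u0 m0 \<rho> u m where eqs: "w0 = (\<rho>0, u0, m0)" "w = (\<rho>, u, m)"
    by (metis prod_cases3)
  have null: "u \<bullet> u = \<rho>\<^sup>2"
    using w eqs by (simp add: wave_cone_def power2_norm_eq_inner)
  have eq: "(\<lambda>s. (case w0 + s *\<^sub>R w of (\<rho>, u, m) \<Rightarrow> (norm u)\<^sup>2 - \<rho>\<^sup>2 - c))
      = (\<lambda>s. 0 * s\<^sup>2 + (2 * (u0 \<bullet> u) - 2 * \<rho>0 * \<rho>) * s + (u0 \<bullet> u0 - \<rho>0\<^sup>2 - c))"
    using null by (intro ext) (simp add: eqs power2_norm_eq_inner inner_add_left inner_add_right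
        inner_commute, simp add: power2_eq_square algebra_simps)
  show "convex_on UNIV (\<lambda>s. case w0 + s *\<^sub>R w of (\<rho>, u, m) \<Rightarrow> (norm u)\<^sup>2 - \<rho>\<^sup>2 - c)"
    unfolding eq by (rule convex_on_quadratic) simp
qed

text \<open>
  Testing the third inequality against a single unit vector \<open>e\<close> turns it into a quadratic condition.
  Its second-order part along a cone direction is \<open>(\<rho>\<^sup>2 - \<rho> (u \<bullet> e))/2\<close>, which is nonnegative
  by Cauchy-Schwarz because \<open>\<bar>u\<bar> = \<bar>\<rho>\<bar>\<close>.
\<close>

lemma Lambda_convex_tested_product:
  assumes e: "norm e = 1"
  shows "Lambda_convex wave_cone
    (\<lambda>(\<rho>, u, m). (m - (1/2 * \<rho>) *\<^sub>R u) \<bullet> e - 1/2 * (1 - \<rho>\<^sup>2))"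
  unfolding Lambda_convex_def
proof (intro allI ballI)
  fix w0 w :: state assume w: "w \<in> wave_cone"
  obtain \<rho>0 u0 m0 \<rho> u m where eqs: "w0 = (\<rho>0, u0, m0)" "w = (\<rho>, u, m)"
    by (metis prod_cases3)
  have "norm u = \<bar>\<rho>\<bar>"
    using w eqs by (simp add: wave_cone_def) (metis power2_abs norm_ge_zero abs_ge_zero power2_eq_imp_eq)
  then have "\<bar>u \<bullet> e\<bar> \<le> \<bar>\<rho>\<bar>"
    using Cauchy_Schwarz_ineq2[of u e] e by simp
  then have "\<bar>\<rho>\<bar> * \<bar>u \<bullet> e\<bar> \<le> \<bar>\<rho>\<bar> * \<bar>\<rho>\<bar>"
    by (intro mult_left_mono) auto
  then have "\<rho> * (u \<bullet> e) \<le> \<rho>\<^sup>2"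
    by (simp add: power2_eq_square) (metis abs_le_D1 abs_mult abs_mult_self_eq)
  then have A: "0 \<le> (\<rho>\<^sup>2 - \<rho> * (u \<bullet> e)) / 2"
    by simp
  have eq: "(\<lambda>s. case w0 + s *\<^sub>R w of (\<rho>, u, m) \<Rightarrow>
          (m - (1/2 * \<rho>) *\<^sub>R u) \<bullet> e - 1/2 * (1 - \<rho>\<^sup>2))
      = (\<lambda>s. ((\<rho>\<^sup>2 - \<rho> * (u \<bullet> e)) / 2) * s\<^sup>2
          + (m \<bullet> e - (\<rho>0 * (u \<bullet> e) + \<rho> * (u0 \<bullet> e)) / 2 + \<rho>0 * \<rho>) * s
          + (m0 \<bullet> e - \<rho>0 * (u0 \<bullet> e) / 2 - (1 - \<rho>0\<^sup>2) / 2))"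
    by (intro ext) (simp add: eqs inner_add_left inner_diff_left power2_eq_square field_simps)
  show "convex_on UNIV (\<lambda>s. case w0 + s *\<^sub>R w of (\<rho>, u, m) \<Rightarrow>
          (m - (1/2 * \<rho>) *\<^sub>R u) \<bullet> e - 1/2 * (1 - \<rho>\<^sup>2))"
    unfolding eq by (rule convex_on_quadratic[OF A])
qed

lemma hull_abs_density:
  assumes "(\<rho>, u, m) \<in> Lambda_hull wave_cone (K_set \<gamma>)"
  shows "\<bar>\<rho>\<bar> \<le> 1"
proof -
  have conv: "convex_on UNIV (\<lambda>z::state. \<bar>fst z\<bar> - 1)"
  proof (rule convex_onI)
    fix t :: real and x y :: state assume t: "0 < t" "t < 1"
    have "\<bar>(1 - t) * fst x + t * fst y\<bar> \<le> (1 - t) * \<bar>fst x\<bar> + t * \<bar>fst y\<bar>"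
      using abs_triangle_ineq[of "(1 - t) * fst x" "t * fst y"] t by (simp add: abs_mult)
    moreover have "(1 - t) * (\<bar>fst x\<bar> - 1) + t * (\<bar>fst y\<bar> - 1)
        = (1 - t) * \<bar>fst x\<bar> + t * \<bar>fst y\<bar> - 1"
      by (simp add: algebra_simps)
    ultimately show "\<bar>fst ((1 - t) *\<^sub>R x + t *\<^sub>R y)\<bar> - 1
        \<le> (1 - t) * (\<bar>fst x\<bar> - 1) + t * (\<bar>fst y\<bar> - 1)"
      by simp
  qed simp
  have "\<bar>fst (\<rho>, u, m)\<bar> - 1 \<le> 0"
    by (rule Lambda_hullD[OF assms convex_imp_Lambda_convex[OF conv]]) (auto simp: K_set_def)
  then show ?thesis by simp
qed

lemma hull_norm_velocity:
  assumes "(\<rho>, u, m) \<in> Lambda_hull wave_cone (K_set \<gamma>)"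
  shows "(norm u)\<^sup>2 \<le> \<gamma>\<^sup>2 - (1 - \<rho>\<^sup>2)"
proof -
  have "(case (\<rho>, u, m) of (\<rho>, u, m) \<Rightarrow> (norm u)\<^sup>2 - \<rho>\<^sup>2 - (\<gamma>\<^sup>2 - 1)) \<le> 0"
  proof (rule Lambda_hullD[OF assms Lambda_convex_norm_sq_diff])
    fix w assume "w \<in> K_set \<gamma>"
    then obtain \<rho> u where w: "w = (\<rho>, u, (1/2 * \<rho>) *\<^sub>R u)" "\<bar>\<rho>\<bar> = 1" "norm u \<le> \<gamma>"
      by (rule K_setE)
    then have "\<rho>\<^sup>2 = 1" "(norm u)\<^sup>2 \<le> \<gamma>\<^sup>2"
      by (auto simp: abs_square_eq_1 power_mono)
    then show "(case w of (\<rho>, u, m) \<Rightarrow> (norm u)\<^sup>2 - \<rho>\<^sup>2 - (\<gamma>\<^sup>2 - 1)) \<le> 0"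
      using w by simp
  qed
  then show ?thesis by simp
qed

lemma hull_norm_product_defect:
  assumes "(\<rho>, u, m) \<in> Lambda_hull wave_cone (K_set \<gamma>)"
  shows "norm (m - (1/2 * \<rho>) *\<^sub>R u) \<le> 1/2 * (1 - \<rho>\<^sup>2)"
proof -
  define v where "v = m - (1/2 * \<rho>) *\<^sub>R u"
  \<comment> \<open>The best test vector is \<open>v/\<bar>v\<bar>\<close>; for \<open>v = 0\<close> any unit vector serves.\<close>
  obtain e where e: "norm e = 1" "v \<bullet> e = norm v"
  proof (cases "v = 0")
    case True
    then show ?thesis using that[of "axis 1 1"] by simp
  next
    case False
    then show ?thesis
      using that[of "v /\<^sub>R norm v"]
      by (simp add: power2_norm_eq_inner[symmetric] power2_eq_square)
  qed
  have "(case (\<rho>, u, m) of (\<rho>, u, m) \<Rightarrow>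
          (m - (1/2 * \<rho>) *\<^sub>R u) \<bullet> e - 1/2 * (1 - \<rho>\<^sup>2)) \<le> 0"
  proof (rule Lambda_hullD[OF assms Lambda_convex_tested_product[OF e(1)]])
    fix w assume "w \<in> K_set \<gamma>"
    then obtain \<rho> u where w: "w = (\<rho>, u, (1/2 * \<rho>) *\<^sub>R u)" "\<bar>\<rho>\<bar> = 1" "norm u \<le> \<gamma>"
      by (rule K_setE)
    then have "\<rho>\<^sup>2 = 1"
      by (auto simp: abs_square_eq_1)
    then show "(case w of (\<rho>, u, m) \<Rightarrow>
          (m - (1/2 * \<rho>) *\<^sub>R u) \<bullet> e - 1/2 * (1 - \<rho>\<^sup>2)) \<le> 0"
      using w by simp
  qed
  then show ?thesis using e(2) by (simp add: v_def)
qed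

text \<open>
  The sign \<open>\<sigma> = 1\<close> gives the fourth inequality and \<open>\<sigma> = -1\<close> the fifth. Both are convex conditions.
  At points of \<open>K_set \<gamma>\<close> with \<open>\<rho> = \<sigma>\<close> the two sides vanish, and at those with \<open>\<rho> = -\<sigma>\<close> they are \<open>\<bar>u\<bar>\<close> and \<open>\<gamma>\<close>.
\<close>

lemma hull_norm_outer:
  assumes "(\<rho>, u, m) \<in> Lambda_hull wave_cone (K_set \<gamma>)" and \<sigma>: "\<bar>\<sigma>\<bar> = 1"
  shows "norm (m - (\<sigma>/2) *\<^sub>R u) \<le> \<gamma>/2 * (1 - \<sigma> * \<rho>)"
proof -
  define f :: "state \<Rightarrow> real" where
    "f = (\<lambda>z. norm (snd (snd z) - (\<sigma>/2) *\<^sub>R fst (snd z)) - \<gamma>/2 * (1 - \<sigma> * fst z))"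
  have conv: "convex_on UNIV f"
  proof (rule convex_onI)
    fix t :: real and x y :: state assume t: "0 < t" "t < 1"
    define L :: "state \<Rightarrow> real^2" where "L z = snd (snd z) - (\<sigma>/2) *\<^sub>R fst (snd z)" for z
    have "L ((1 - t) *\<^sub>R x + t *\<^sub>R y) = (1 - t) *\<^sub>R L x + t *\<^sub>R L y"
      by (simp add: L_def algebra_simps diff_divide_distrib)
    then have "norm (L ((1 - t) *\<^sub>R x + t *\<^sub>R y)) \<le> (1 - t) * norm (L x) + t * norm (L y)"
      using norm_triangle_ineq[of "(1 - t) *\<^sub>R L x" "t *\<^sub>R L y"] t by simp
    then show "f ((1 - t) *\<^sub>R x + t *\<^sub>R y) \<le> (1 - t) * f x + t * f y"
      unfolding f_def L_def[symmetric] by (simp add: field_simps)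
  qed simp
  have "f (\<rho>, u, m) \<le> 0"
  proof (rule Lambda_hullD[OF assms(1) convex_imp_Lambda_convex[OF conv]])
    fix w assume "w \<in> K_set \<gamma>"
    then obtain \<rho> u where w: "w = (\<rho>, u, (1/2 * \<rho>) *\<^sub>R u)" "\<bar>\<rho>\<bar> = 1" "norm u \<le> \<gamma>"
      by (rule K_setE)
    have "f w = norm (((\<rho> - \<sigma>) / 2) *\<^sub>R u) - \<gamma>/2 * (1 - \<sigma> * \<rho>)"
      by (simp add: w(1) f_def scaleR_left_diff_distrib diff_divide_distrib)
    also have "\<dots> = \<bar>\<rho> - \<sigma>\<bar> / 2 * norm u - \<gamma>/2 * (1 - \<sigma> * \<rho>)"
      by simp
    finally have fw: "f w = \<bar>\<rho> - \<sigma>\<bar> / 2 * norm u - \<gamma>/2 * (1 - \<sigma> * \<rho>)" .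
    have "\<rho> = \<sigma> \<or> \<rho> = - \<sigma>" "\<sigma> * \<sigma> = 1"
      using w(2) \<sigma> by (auto simp: abs_if split: if_splits)
    then show "f w \<le> 0"
      using fw w(3) \<sigma> by (auto simp: abs_mult)
  qed
  then show ?thesis by (simp add: f_def)
qed

section \<open>States as combinations of the two phases\<close>

text \<open>
  The combination of \<open>(1, a, a/2)\<close> and \<open>(-1, b, -b/2)\<close> with weights \<open>\<theta>\<close> and \<open>1 - \<theta>\<close>.
\<close>

definition phase_mix :: "real \<Rightarrow> real^2 \<Rightarrow> real^2 \<Rightarrow> state" where
  "phase_mix \<theta> a b =
     (2 * \<theta> - 1, \<theta> *\<^sub>R a + (1 - \<theta>) *\<^sub>R b, (1/2) *\<^sub>R (\<theta> *\<^sub>R a - (1 - \<theta>) *\<^sub>R b))"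

lemma phase_mix_0_in_hull:
  assumes "norm b \<le> \<gamma>"
  shows "phase_mix 0 a b \<in> Lambda_hull wave_cone (K_set \<gamma>)"
  using assms subset_Lambda_hull by (force simp: phase_mix_def K_set_def)

lemma phase_mix_1_in_hull:
  assumes "norm a \<le> \<gamma>"
  shows "phase_mix 1 a b \<in> Lambda_hull wave_cone (K_set \<gamma>)"
  using assms subset_Lambda_hull by (force simp: phase_mix_def K_set_def)

lemma reflect_phase_mix_in_hull:
  assumes "phase_mix \<theta> a b \<in> Lambda_hull wave_cone (K_set \<gamma>)"
  shows "phase_mix (1 - \<theta>) b a \<in> Lambda_hull wave_cone (K_set \<gamma>)"
proof -
  define R :: "state \<Rightarrow> state" where "R = (\<lambda>(\<rho>, u, m). (- \<rho>, u, - m))"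
  have "linear R"
    by (rule linearI) (auto simp: R_def)
  moreover have "R ` wave_cone \<subseteq> wave_cone"
    by (auto simp: R_def wave_cone_def)
  moreover have "R ` K_set \<gamma> \<subseteq> K_set \<gamma>"
    by (auto simp: R_def K_set_def)
  moreover have "R (phase_mix \<theta> a b) = phase_mix (1 - \<theta>) b a"
    by (simp add: R_def phase_mix_def algebra_simps)
  ultimately show ?thesis
    using Lambda_hull_linear_image[OF _ _ _ assms] by metis
qed

lemma phase_mix_in_hull_distance_2:
  assumes "norm a \<le> \<gamma>" "norm b \<le> \<gamma>" "norm (a - b) = 2" "0 \<le> \<theta>" "\<theta> \<le> 1"
  shows "phase_mix \<theta> a b \<in> Lambda_hull wave_cone (K_set \<gamma>)"
proof (rule Lambda_hull_segment[OF phase_mix_0_in_hull[OF assms(2)] phase_mix_1_in_hull[OF assms(1)]])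
  show "phase_mix 1 a b - phase_mix 0 a b \<in> wave_cone"
    using assms(3) by (simp add: phase_mix_def wave_cone_def)
  show "phase_mix \<theta> a b \<in> closed_segment (phase_mix 0 a b) (phase_mix 1 a b)"
    unfolding closed_segment_def using assms(4,5)
    by (intro CollectI exI[of _ \<theta>]) (simp add: phase_mix_def algebra_simps diff_divide_distrib)
qed

section \<open>Moving one phase along a chord\<close>

text \<open>
  This produces states whose phases are less than 2 apart. Fix \<open>a\<close> and let the state move in the cone direction with \<open>\<rho>\<close>-component 2 and
  \<open>u\<close>-component \<open>a - c\<close>, in such a way that its first phase remains \<open>a\<close>. Its second phase then
  runs along the line through \<open>c\<close> and \<open>b\<close>. Moving until that phase is \<open>d\<close> gives a state at which
  the distance of the phases is 2; moving backwards until \<open>\<rho> = -1\<close> gives the velocity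
  \<open>\<theta> c + (1 - \<theta>) b\<close>.
\<close>

lemma chord_in_hull:
  assumes a: "norm a \<le> \<gamma>" and c: "norm (a - c) = 2" and d: "norm (a - d) = 2"
    and b: "b = (1 - \<tau>) *\<^sub>R c + \<tau> *\<^sub>R d" and \<tau>: "0 \<le> \<tau>" "\<tau> \<le> 1" and \<theta>: "0 < \<theta>" "\<theta> < 1"
    and d\<gamma>: "norm d \<le> \<gamma>" and b0\<gamma>: "norm (\<theta> *\<^sub>R c + (1 - \<theta>) *\<^sub>R b) \<le> \<gamma>"
  shows "phase_mix \<theta> a b \<in> Lambda_hull wave_cone (K_set \<gamma>)"
proof -
  \<comment> \<open>the weight of the first phase at the moment when the second phase has reached \<open>d\<close>\<close>
  define \<mu> where "\<mu> = 1 - \<tau> * (1 - \<theta>)"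
  define b0 where "b0 = \<theta> *\<^sub>R c + (1 - \<theta>) *\<^sub>R b"
  have "\<tau> * (1 - \<theta>) \<le> 1 - \<theta>" "0 \<le> \<tau> * (1 - \<theta>)"
    using \<tau> \<theta> by (auto simp: mult_left_le_one_le)
  then have \<mu>: "\<theta> \<le> \<mu>" "\<mu> \<le> 1" "0 < \<mu>"
    unfolding \<mu>_def using \<theta>(1) by linarith+
  have end1: "phase_mix \<mu> a d \<in> Lambda_hull wave_cone (K_set \<gamma>)"
    using phase_mix_in_hull_distance_2[OF a d\<gamma> d] \<mu> by simp
  have end0: "phase_mix 0 a b0 \<in> Lambda_hull wave_cone (K_set \<gamma>)"
    using phase_mix_0_in_hull b0\<gamma> b0_def by simp
  have dd: "(1 - \<mu>) *\<^sub>R d = (\<theta> - \<mu>) *\<^sub>R c + (1 - \<theta>) *\<^sub>R b"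
    by (simp add: \<mu>_def b algebra_simps)
  have dir_u: "\<mu> *\<^sub>R a + (1 - \<mu>) *\<^sub>R d - b0 = \<mu> *\<^sub>R (a - c)"
    unfolding dd by (simp add: b0_def algebra_simps)
  have "phase_mix \<mu> a d - phase_mix 0 a b0 \<in> wave_cone"
    using c \<mu> dir_u by (simp add: phase_mix_def wave_cone_def)
  moreover have "phase_mix \<theta> a b
      = (1 - \<theta> / \<mu>) *\<^sub>R phase_mix 0 a b0 + (\<theta> / \<mu>) *\<^sub>R phase_mix \<mu> a d"
  proof -
    have mix: "(1 - \<theta> / \<mu>) *\<^sub>R b0 + (\<theta> / \<mu>) *\<^sub>R ((1 - \<mu>) *\<^sub>R d) = (1 - \<theta>) *\<^sub>R b"
    proof -
      have "\<theta> - \<theta> * \<theta> / \<mu> + \<theta> / \<mu> * (\<theta> - \<mu>) = 0"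
        using \<mu> by (simp add: field_simps)
      then have "(\<theta> - \<theta> * \<theta> / \<mu> + \<theta> / \<mu> * (\<theta> - \<mu>)) *\<^sub>R c = 0"
        by simp
      then show ?thesis
        unfolding dd b0_def using \<mu>(3) by (simp add: algebra_simps)
    qed
    have second: "(1 - \<theta> / \<mu>) *\<^sub>R b0 + (\<theta> / \<mu>) *\<^sub>R (\<mu> *\<^sub>R a + (1 - \<mu>) *\<^sub>R d)
        = \<theta> *\<^sub>R a + (1 - \<theta>) *\<^sub>R b"
      using \<mu> mix by (simp add: scaleR_add_right)
    have "(1 - \<theta> / \<mu>) *\<^sub>R (- b0) + (\<theta> / \<mu>) *\<^sub>R (\<mu> *\<^sub>R a - (1 - \<mu>) *\<^sub>R d)
        = \<theta> *\<^sub>R a - (1 - \<theta>) *\<^sub>R b"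
      using \<mu> mix[symmetric] by (simp add: scaleR_diff_right)
    then have third: "(1 - \<theta> / \<mu>) *\<^sub>R ((1/2) *\<^sub>R (- b0))
        + (\<theta> / \<mu>) *\<^sub>R ((1/2) *\<^sub>R (\<mu> *\<^sub>R a - (1 - \<mu>) *\<^sub>R d))
        = (1/2) *\<^sub>R (\<theta> *\<^sub>R a - (1 - \<theta>) *\<^sub>R b)"
      by (metis scaleR_add_right scaleR_left_commute)
    have first: "(1 - \<theta> / \<mu>) * (- 1) + \<theta> / \<mu> * (2 * \<mu> - 1) = 2 * \<theta> - 1"
      using \<mu> by (simp add: field_simps)
    have "phase_mix 0 a b0 = (- 1, b0, (1/2) *\<^sub>R (- b0))"
      by (simp add: phase_mix_def)
    then show ?thesis
      by (simp only: phase_mix_def scaleR_Pair add_Pair real_scaleR_def first second third)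
  qed
  then have "phase_mix \<theta> a b \<in> closed_segment (phase_mix 0 a b0) (phase_mix \<mu> a d)"
    unfolding closed_segment_def using \<mu> \<theta> by (intro CollectI exI[of _ "\<theta> / \<mu>"]) simp
  ultimately show ?thesis
    using Lambda_hull_segment[OF end0 end1] by blast
qed

lemma chord_through_interior_point:
  fixes a b c :: "'a::real_normed_vector"
  assumes b: "norm (a - b) < r" and c: "norm (a - c) = r"
  obtains d \<tau> where "norm (a - d) = r" "0 < \<tau>" "\<tau> \<le> 1" "b = (1 - \<tau>) *\<^sub>R c + \<tau> *\<^sub>R d"
proof -
  define g where "g t = norm (a - c - t *\<^sub>R (b - c))" for t :: real
  define T where "T = max 1 (2 * r / norm (b - c))"
  have bc: "0 < norm (b - c)" using b c by auto
  have g1: "g 1 \<le> r" using b by (simp add: g_def)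
  have T1: "1 \<le> T" by (simp add: T_def)
  have "2 * r \<le> T * norm (b - c)"
    using bc by (simp add: T_def pos_divide_le_eq[symmetric])
  moreover have "T * norm (b - c) = norm (T *\<^sub>R (b - c))"
    using T1 by simp
  moreover have "norm (T *\<^sub>R (b - c)) - norm (a - c) \<le> g T"
    unfolding g_def using norm_triangle_ineq2[of "T *\<^sub>R (b - c)" "a - c"]
    by (simp add: norm_minus_commute)
  ultimately have gT: "r \<le> g T" using c by linarith
  have "continuous_on {1..T} g"
    unfolding g_def by (intro continuous_intros)
  then obtain t where t: "1 \<le> t" "g t = r"
    using IVT'[OF g1 gT T1] by blast
  show ?thesis
  proof (rule that[of "c + t *\<^sub>R (b - c)" "1 / t"])
    show "norm (a - (c + t *\<^sub>R (b - c))) = r"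
      using t by (simp add: g_def algebra_simps)
    show "b = (1 - 1 / t) *\<^sub>R c + (1 / t) *\<^sub>R (c + t *\<^sub>R (b - c))"
      using t by (simp add: algebra_simps)
  qed (use t in auto)
qed

text \<open>
  In dimension at least 2 the unit sphere is connected, so \<open>u \<bullet> e\<close> takes all values between its
  extremes \<open>-\<bar>u\<bar>\<close> and \<open>\<bar>u\<bar>\<close>.
\<close>

lemma unit_vector_with_inner:
  fixes u :: "'a::euclidean_space"
  assumes dim: "2 \<le> DIM('a)" and x: "\<bar>x\<bar> \<le> norm u"
  obtains e where "norm e = 1" "u \<bullet> e = x"
proof (cases "u = 0")
  case True
  obtain e :: 'a where "norm e = 1"
    using vector_choose_size[of 1] by auto
  then show ?thesis using that True x by simp
next
  case False
  have conn: "connected ((\<lambda>e. u \<bullet> e) ` sphere 0 1)"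
    by (intro connected_continuous_image continuous_intros connected_sphere dim)
  define v where "v = u /\<^sub>R norm u"
  have v: "norm v = 1" "u \<bullet> v = norm u"
    using False by (simp_all add: v_def power2_norm_eq_inner[symmetric] power2_eq_square)
  then have "norm u \<in> (\<lambda>e. u \<bullet> e) ` sphere 0 1" "- norm u \<in> (\<lambda>e. u \<bullet> e) ` sphere 0 1"
    by (auto intro: image_eqI[of _ _ v] image_eqI[of _ _ "- v"])
  then have "x \<in> (\<lambda>e. u \<bullet> e) ` sphere 0 1"
    using connectedD_interval[OF conn, of "- norm u" "norm u" x] x by auto
  then show ?thesis using that by auto
qed

lemma norm_sq_convex_combination:
  fixes x y :: "'a::real_inner"
  shows "(norm (t *\<^sub>R x + (1 - t) *\<^sub>R y))\<^sup>2
    = t * (norm x)\<^sup>2 + (1 - t) * (norm y)\<^sup>2 - t * (1 - t) * (norm (x - y))\<^sup>2"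
  by (simp add: power2_norm_eq_inner inner_add_left inner_add_right inner_diff_left
      inner_diff_right inner_commute, simp add: power2_eq_square algebra_simps)

lemma norm_sq_add_unit:
  fixes u e :: "'a::real_inner"
  assumes "norm e = 1"
  shows "(norm (u + t *\<^sub>R e))\<^sup>2 = (norm u)\<^sup>2 + 2 * t * (u \<bullet> e) + t\<^sup>2"
proof -
  have "e \<bullet> e = 1" using assms by (simp add: norm_eq_1)
  then show ?thesis
    by (simp add: power2_norm_eq_inner inner_add_left inner_add_right
        inner_commute, simp add: power2_eq_square algebra_simps)
qed

text \<open>
  Here the chord has to be chosen. Along the motion of \<open>chord_in_hull\<close>, with \<open>a - c = 2 e\<close>, the
  quantity \<open>\<bar>u\<bar>\<^sup>2 - \<rho>\<^sup>2\<close> is affine with slope a positive multiple of \<open>u \<bullet> e - \<rho>\<close>. Where it is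
  at most \<open>\<gamma>\<^sup>2 - 1\<close> at an end of the motion, the velocity there is bounded by \<open>\<gamma>\<close>: that of the state
  itself at the end with \<open>\<rho> = -1\<close>, that of the second phase \<open>d\<close> at the other.

  If \<open>\<bar>\<rho>\<bar> \<le> \<bar>u\<bar>\<close>, a direction \<open>e\<close> with \<open>u \<bullet> e = \<rho>\<close> makes this quantity constant, so both ends
  inherit the bound. Otherwise \<open>\<rho> < 0\<close>, because \<open>\<bar>u\<bar> \<ge> \<gamma> - 2 (1 - \<theta>) > \<rho>\<close>. Then the slope is
  nonnegative for every \<open>e\<close>, which takes care of the backward end, and the forward end \<open>d\<close> can be
  prescribed: \<open>d = (1 - 2/\<gamma>) a\<close> has distance 2 from \<open>a\<close> and norm \<open>\<bar>\<gamma> - 2\<bar> \<le> \<gamma>\<close>.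
\<close>

lemma outer_boundary_in_hull:
  assumes \<gamma>: "\<gamma> > 1" and a: "norm a = \<gamma>" and ab: "norm (a - b) < 2" and \<theta>: "0 < \<theta>" "\<theta> < 1"
    and F: "(norm (\<theta> *\<^sub>R a + (1 - \<theta>) *\<^sub>R b))\<^sup>2 \<le> \<gamma>\<^sup>2 - (1 - (2 * \<theta> - 1)\<^sup>2)"
  shows "phase_mix \<theta> a b \<in> Lambda_hull wave_cone (K_set \<gamma>)"
proof -
  define u where "u = \<theta> *\<^sub>R a + (1 - \<theta>) *\<^sub>R b"
  define \<rho> where "\<rho> = 2 * \<theta> - 1"
  note F' = F[folded u_def \<rho>_def]
  have backward: "norm (\<theta> *\<^sub>R c + (1 - \<theta>) *\<^sub>R b) \<le> \<gamma>"
    if e: "norm e = 1" "c = a - 2 *\<^sub>R e" "\<rho> \<le> u \<bullet> e" for c e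
  proof -
    have "\<theta> *\<^sub>R c + (1 - \<theta>) *\<^sub>R b = u + (- 2 * \<theta>) *\<^sub>R e"
      by (simp add: u_def e(2) algebra_simps)
    then have "(norm (\<theta> *\<^sub>R c + (1 - \<theta>) *\<^sub>R b))\<^sup>2
        = (norm u)\<^sup>2 + (1 - \<rho>\<^sup>2) - 4 * \<theta> * (u \<bullet> e - \<rho>)"
      by (simp only: norm_sq_add_unit[OF e(1)]) (simp add: \<rho>_def power2_eq_square algebra_simps)
    moreover have "0 \<le> 4 * \<theta> * (u \<bullet> e - \<rho>)"
      using \<theta> e(3) by simp
    ultimately have "(norm (\<theta> *\<^sub>R c + (1 - \<theta>) *\<^sub>R b))\<^sup>2 \<le> \<gamma>\<^sup>2"
      using F' by linarith
    then show ?thesis by (rule power2_le_imp_le) (use \<gamma> in simp)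
  qed
  show ?thesis
  proof (cases "\<bar>\<rho>\<bar> \<le> norm u")
    case True
    obtain e where e: "norm e = 1" "u \<bullet> e = \<rho>"
      using unit_vector_with_inner[of \<rho> u] True by auto
    define c where "c = a - 2 *\<^sub>R e"
    have c: "norm (a - c) = 2" using e by (simp add: c_def)
    obtain d \<tau> where d: "norm (a - d) = 2" "0 < \<tau>" "\<tau> \<le> 1" "b = (1 - \<tau>) *\<^sub>R c + \<tau> *\<^sub>R d"
      using chord_through_interior_point[OF ab c] by blast
    \<comment> \<open>the weight of the first phase at the moment when the second phase has reached \<open>d\<close>\<close>
    define \<mu> where "\<mu> = 1 - \<tau> * (1 - \<theta>)"
    have \<mu>: "\<mu> < 1" using d \<theta> by (simp add: \<mu>_def)
    have "\<mu> *\<^sub>R a + (1 - \<mu>) *\<^sub>R d = u + (2 * (\<mu> - \<theta>)) *\<^sub>R e"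
    proof -
      have "(1 - \<mu>) *\<^sub>R d = (\<theta> - \<mu>) *\<^sub>R c + (1 - \<theta>) *\<^sub>R b"
        by (simp add: \<mu>_def d(4) algebra_simps)
      then show ?thesis by (simp add: u_def c_def algebra_simps)
    qed
    then have "(norm (\<mu> *\<^sub>R a + (1 - \<mu>) *\<^sub>R d))\<^sup>2
        = (norm u)\<^sup>2 + 4 * (\<mu> - \<theta>) * \<rho> + 4 * (\<mu> - \<theta>)\<^sup>2"
      by (simp only: norm_sq_add_unit[OF e(1)] e(2)) (simp add: power2_eq_square algebra_simps)
    also have "\<dots> = (norm u)\<^sup>2 + (1 - \<rho>\<^sup>2) - 4 * \<mu> * (1 - \<mu>)"
      by (simp add: \<rho>_def power2_eq_square algebra_simps)
    finally have "\<mu> * \<gamma>\<^sup>2 + (1 - \<mu>) * (norm d)\<^sup>2 = (norm u)\<^sup>2 + (1 - \<rho>\<^sup>2)"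
      unfolding norm_sq_convex_combination a d(1) by simp
    then have "(1 - \<mu>) * (norm d)\<^sup>2 \<le> (1 - \<mu>) * \<gamma>\<^sup>2"
      using F' by (simp add: algebra_simps)
    then have "(norm d)\<^sup>2 \<le> \<gamma>\<^sup>2" using \<mu> by simp
    then have "norm d \<le> \<gamma>" by (rule power2_le_imp_le) (use \<gamma> in simp)
    then show ?thesis
      using chord_in_hull[OF _ c d(1,4) _ d(3) \<theta>] backward[OF e(1) c_def] e(2) a d(2) by simp
  next
    case False
    have "a = u + (1 - \<theta>) *\<^sub>R (a - b)"
      by (simp add: u_def algebra_simps)
    then have "\<gamma> \<le> norm u + norm ((1 - \<theta>) *\<^sub>R (a - b))"
      using a norm_triangle_ineq by metis
    moreover have "norm ((1 - \<theta>) *\<^sub>R (a - b)) \<le> (1 - \<theta>) * 2"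
      using mult_left_mono[of "norm (a - b)" 2 "1 - \<theta>"] ab \<theta> by simp
    ultimately have "\<rho> < norm u"
      using \<gamma> by (simp add: \<rho>_def)
    then have \<rho>: "\<rho> < - norm u" using False by linarith
    define d where "d = (1 - 2 / \<gamma>) *\<^sub>R a"
    have "a - d = (2 / \<gamma>) *\<^sub>R a"
      by (simp add: d_def algebra_simps)
    then have d: "norm (a - d) = 2" using a \<gamma> by simp
    have "norm d = \<bar>(1 - 2 / \<gamma>) * \<gamma>\<bar>" using a \<gamma> by (simp add: d_def abs_mult)
    also have "(1 - 2 / \<gamma>) * \<gamma> = \<gamma> - 2" using \<gamma> by (simp add: field_simps)
    finally have d\<gamma>: "norm d \<le> \<gamma>" using \<gamma> by simp
    obtain c \<tau> where c: "norm (a - c) = 2" "0 < \<tau>" "\<tau> \<le> 1" "b = (1 - \<tau>) *\<^sub>R d + \<tau> *\<^sub>R c"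
      using chord_through_interior_point[OF ab d] by blast
    define e where "e = (1/2) *\<^sub>R (a - c)"
    have e: "norm e = 1" "c = a - 2 *\<^sub>R e"
      using c by (auto simp: e_def)
    have "\<bar>u \<bullet> e\<bar> \<le> norm u"
      using Cauchy_Schwarz_ineq2[of u e] e by simp
    then have "\<rho> \<le> u \<bullet> e" using \<rho> by linarith
    then show ?thesis
      using chord_in_hull[OF _ c(1) d _ _ _ \<theta> d\<gamma> backward[OF e], of "1 - \<tau>"] a c by simp
  qed
qed

section \<open>States satisfying the inequalities lie in the hull\<close>

lemma extreme_flux_in_hull:
  assumes \<gamma>: "\<gamma> > 1" and \<rho>: "\<bar>\<rho>\<bar> < 1"
    and u: "(norm u)\<^sup>2 \<le> \<gamma>\<^sup>2 - (1 - \<rho>\<^sup>2)"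
    and m: "norm (m - (1/2 * \<rho>) *\<^sub>R u) \<le> 1/2 * (1 - \<rho>\<^sup>2)"
      "norm (m - (1/2) *\<^sub>R u) \<le> \<gamma>/2 * (1 - \<rho>)"
      "norm (m + (1/2) *\<^sub>R u) \<le> \<gamma>/2 * (1 + \<rho>)"
    and extreme: "norm (m - (1/2 * \<rho>) *\<^sub>R u) = 1/2 * (1 - \<rho>\<^sup>2) \<or>
      norm (m - (1/2) *\<^sub>R u) = \<gamma>/2 * (1 - \<rho>) \<or>
      norm (m + (1/2) *\<^sub>R u) = \<gamma>/2 * (1 + \<rho>)"
  shows "(\<rho>, u, m) \<in> Lambda_hull wave_cone (K_set \<gamma>)"
proof -
  define \<theta> where "\<theta> = (1 + \<rho>) / 2"
  define a where "a = (1 / \<theta>) *\<^sub>R (m + (1/2) *\<^sub>R u)"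
  define b where "b = (1 / (1 - \<theta>)) *\<^sub>R ((1/2) *\<^sub>R u - m)"
  have \<theta>: "0 < \<theta>" "\<theta> < 1" and \<rho>\<theta>: "\<rho> = 2 * \<theta> - 1"
    using \<rho> by (auto simp: \<theta>_def field_simps)
  have la: "\<theta> *\<^sub>R a = m + (1/2) *\<^sub>R u" and lb: "(1 - \<theta>) *\<^sub>R b = (1/2) *\<^sub>R u - m"
    using \<theta> by (auto simp: a_def b_def)
  have uab: "\<theta> *\<^sub>R a + (1 - \<theta>) *\<^sub>R b = u"
    unfolding la lb by (simp add: scaleR_add_left[symmetric])
  have mab: "(1/2) *\<^sub>R (\<theta> *\<^sub>R a - (1 - \<theta>) *\<^sub>R b) = m"
    unfolding la lb by (simp add: scaleR_2[symmetric])
  have z: "(\<rho>, u, m) = phase_mix \<theta> a b"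
    by (simp add: phase_mix_def uab mab \<rho>\<theta>)
  have na: "norm (m + (1/2) *\<^sub>R u) = \<theta> * norm a"
    using \<theta> by (simp add: la[symmetric])
  have nb: "norm (m - (1/2) *\<^sub>R u) = (1 - \<theta>) * norm b"
    using \<theta> by (simp add: norm_minus_commute[of m] lb[symmetric])
  have "m - (1/2 * \<rho>) *\<^sub>R u = (\<theta> * (1 - \<theta>)) *\<^sub>R (a - b)"
  proof -
    have "(\<theta> * (1 - \<theta>)) *\<^sub>R (a - b) = (1 - \<theta>) *\<^sub>R (\<theta> *\<^sub>R a) - \<theta> *\<^sub>R ((1 - \<theta>) *\<^sub>R b)"
      by (simp add: algebra_simps)
    also have "\<dots> = m - (\<theta> * (1/2) - (1 - \<theta>) * (1/2)) *\<^sub>R u"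
      unfolding la lb by (simp add: vec_eq_iff field_simps)
    also have "\<theta> * (1/2) - (1 - \<theta>) * (1/2) = 1/2 * \<rho>"
      by (simp add: \<rho>\<theta> field_simps)
    finally show ?thesis by (rule sym)
  qed
  then have nab: "norm (m - (1/2 * \<rho>) *\<^sub>R u) = \<theta> * (1 - \<theta>) * norm (a - b)"
    using \<theta> by simp
  have rad: "1/2 * (1 - \<rho>\<^sup>2) = \<theta> * (1 - \<theta>) * 2" "\<gamma>/2 * (1 - \<rho>) = (1 - \<theta>) * \<gamma>"
    "\<gamma>/2 * (1 + \<rho>) = \<theta> * \<gamma>"
    by (auto simp: \<rho>\<theta> power2_eq_square algebra_simps)
  have pos: "0 < \<theta>" "0 < 1 - \<theta>" "0 < \<theta> * (1 - \<theta>)"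
    using \<theta> by simp_all
  have ineqs: "norm (a - b) \<le> 2" "norm b \<le> \<gamma>" "norm a \<le> \<gamma>"
    using m unfolding nab na nb rad by (simp_all only: mult_le_cancel_left_pos[OF pos(1)]
        mult_le_cancel_left_pos[OF pos(2)] mult_le_cancel_left_pos[OF pos(3)])
  have eqs: "norm (a - b) = 2 \<or> norm b = \<gamma> \<or> norm a = \<gamma>"
    using extreme pos unfolding nab na nb rad by (simp only: mult_cancel_left) auto
  have F: "(norm (\<theta> *\<^sub>R a + (1 - \<theta>) *\<^sub>R b))\<^sup>2 \<le> \<gamma>\<^sup>2 - (1 - (2 * \<theta> - 1)\<^sup>2)"
    using u by (simp add: uab \<rho>\<theta>)
  show ?thesis
  proof (cases "norm (a - b) = 2")
    case True
    then show ?thesis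
      unfolding z using phase_mix_in_hull_distance_2 ineqs \<theta> by simp
  next
    case False
    then have ab: "norm (a - b) < 2" using ineqs by simp
    from eqs False consider "norm a = \<gamma>" | "norm b = \<gamma>" by blast
    then show ?thesis
    proof cases
      case 1
      then show ?thesis
        unfolding z using outer_boundary_in_hull[OF \<gamma> _ ab \<theta> F] by simp
    next
      case 2
      have "(norm ((1 - \<theta>) *\<^sub>R b + (1 - (1 - \<theta>)) *\<^sub>R a))\<^sup>2 \<le> \<gamma>\<^sup>2 - (1 - (2 * (1 - \<theta>) - 1)\<^sup>2)"
        using F by (simp add: add.commute power2_eq_square algebra_simps)
      then have "phase_mix (1 - \<theta>) b a \<in> Lambda_hull wave_cone (K_set \<gamma>)"
        using outer_boundary_in_hull[OF \<gamma> 2, of a "1 - \<theta>"] ab \<theta> by (simp add: norm_minus_commute)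
      then show ?thesis
        unfolding z using reflect_phase_mix_in_hull by fastforce
    qed
  qed
qed

text \<open>
  Purely in \<open>m\<close>, every direction belongs to the cone, and the admissible \<open>m\<close> form an intersection
  of three discs. Along a line through an admissible \<open>m\<close>, the largest of the three excesses of
  distance over radius is continuous, nonpositive at \<open>m\<close>, and nonnegative far enough away, so it
  vanishes on either side.
\<close>

lemma inequalities_in_hull:
  assumes \<gamma>: "\<gamma> > 1" and \<rho>: "\<bar>\<rho>\<bar> < 1"
    and u: "(norm u)\<^sup>2 \<le> \<gamma>\<^sup>2 - (1 - \<rho>\<^sup>2)"
    and m: "norm (m - (1/2 * \<rho>) *\<^sub>R u) \<le> 1/2 * (1 - \<rho>\<^sup>2)"
      "norm (m - (1/2) *\<^sub>R u) \<le> \<gamma>/2 * (1 - \<rho>)"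
      "norm (m + (1/2) *\<^sub>R u) \<le> \<gamma>/2 * (1 + \<rho>)"
  shows "(\<rho>, u, m) \<in> Lambda_hull wave_cone (K_set \<gamma>)"
proof -
  define g where "g m = max (norm (m - (1/2 * \<rho>) *\<^sub>R u) - 1/2 * (1 - \<rho>\<^sup>2))
     (max (norm (m - (1/2) *\<^sub>R u) - \<gamma>/2 * (1 - \<rho>))
          (norm (m + (1/2) *\<^sub>R u) - \<gamma>/2 * (1 + \<rho>)))" for m
  have g0: "g m \<le> 0" using m by (simp add: g_def)
  have zero_in_hull: "(\<rho>, u, m') \<in> Lambda_hull wave_cone (K_set \<gamma>)" if "g m' = 0" for m'
    using that unfolding g_def by (intro extreme_flux_in_hull[OF \<gamma> \<rho> u]) linarith+
  have zero_on_ray: "\<exists>t\<ge>0. g (m + t *\<^sub>R v) = 0" if v: "norm v = 1" for v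
  proof -
    define T where "T = 1 - \<rho>\<^sup>2"
    have "\<rho>\<^sup>2 \<le> 1" using \<rho> by (simp add: abs_square_le_1)
    then have T: "0 \<le> T" by (simp add: T_def)
    \<comment> \<open>\<open>T\<close> is the diameter of the disc of the third inequality, so \<open>m + T v\<close> is not interior.\<close>
    have "norm (T *\<^sub>R v) \<le> norm (m + T *\<^sub>R v - (1/2 * \<rho>) *\<^sub>R u) + norm (m - (1/2 * \<rho>) *\<^sub>R u)"
      using norm_triangle_ineq4[of "m + T *\<^sub>R v - (1/2 * \<rho>) *\<^sub>R u" "m - (1/2 * \<rho>) *\<^sub>R u"] by simp
    moreover have "norm (T *\<^sub>R v) = T"
      using v T by simp
    ultimately have "1/2 * T \<le> norm (m + T *\<^sub>R v - (1/2 * \<rho>) *\<^sub>R u)"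
      using m(1)[folded T_def] by linarith
    then have gT: "0 \<le> g (m + T *\<^sub>R v)"
      unfolding g_def T_def[symmetric] by (intro max.coboundedI1) linarith
    have "continuous_on {0..T} (\<lambda>t. g (m + t *\<^sub>R v))"
      unfolding g_def by (intro continuous_intros)
    then show ?thesis
      using IVT'[of "\<lambda>t. g (m + t *\<^sub>R v)" 0 0 T] g0 gT T by auto
  qed
  obtain v :: "real^2" where v: "norm v = 1"
    using vector_choose_size[of 1] by auto
  obtain s where s: "0 \<le> s" "g (m + s *\<^sub>R v) = 0"
    using zero_on_ray[OF v] by blast
  obtain t where t: "0 \<le> t" "g (m + t *\<^sub>R (- v)) = 0"
    using zero_on_ray[of "- v"] v by auto
  show ?thesis
  proof (rule Lambda_hull_segment[OF zero_in_hull[OF t(2)] zero_in_hull[OF s(2)]])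
    show "(\<rho>, u, m + s *\<^sub>R v) - (\<rho>, u, m + t *\<^sub>R (- v)) \<in> wave_cone"
      by (simp add: wave_cone_def)
    show "(\<rho>, u, m) \<in> closed_segment (\<rho>, u, m + t *\<^sub>R (- v)) (\<rho>, u, m + s *\<^sub>R v)"
    proof (cases "s + t = 0")
      case True
      then have "s = 0" "t = 0" using s(1) t(1) by auto
      then show ?thesis by simp
    next
      case False
      define x where "x = t / (s + t)"
      have x: "0 \<le> x" "x \<le> 1"
        using s(1) t(1) False by (auto simp: x_def)
      have "(1 - x) *\<^sub>R (m + t *\<^sub>R (- v)) + x *\<^sub>R (m + s *\<^sub>R v) = m + (x * s - (1 - x) * t) *\<^sub>R v"
        by (simp add: algebra_simps)
      also have "x * s - (1 - x) * t = 0"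
        using False by (simp add: x_def field_simps)
      finally have flux: "(1 - x) *\<^sub>R (m + t *\<^sub>R (- v)) + x *\<^sub>R (m + s *\<^sub>R v) = m"
        by simp
      have const: "(1 - x) * \<rho> + x * \<rho> = \<rho>" "(1 - x) *\<^sub>R u + x *\<^sub>R u = u"
        by (auto simp: algebra_simps)
      have "(\<rho>, u, m) = (1 - x) *\<^sub>R (\<rho>, u, m + t *\<^sub>R (- v)) + x *\<^sub>R (\<rho>, u, m + s *\<^sub>R v)"
        by (simp only: scaleR_Pair add_Pair real_scaleR_def flux const)
      then show ?thesis
        unfolding closed_segment_def using x by blast
    qed
  qed
qed

theorem proposition2p5:
  fixes \<gamma> :: real
  assumes "\<gamma> > 1"
  shows "Lambda_hull wave_cone (K_set \<gamma>) =
    {(\<rho>, u, m).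
       \<bar>\<rho>\<bar> \<le> 1 \<and>
       (norm u)\<^sup>2 \<le> \<gamma>\<^sup>2 - (1 - \<rho>\<^sup>2) \<and>
       norm (m - (1/2 * \<rho>) *\<^sub>R u) \<le> 1/2 * (1 - \<rho>\<^sup>2) \<and>
       norm (m - (1/2) *\<^sub>R u) \<le> \<gamma>/2 * (1 - \<rho>) \<and>
       norm (m + (1/2) *\<^sub>R u) \<le> \<gamma>/2 * (1 + \<rho>)}"
    (is "?H = ?S")
proof (intro set_eqI iffI)
  fix z assume z: "z \<in> ?H"
  obtain \<rho> u m where "z = (\<rho>, u, m)" by (metis prod_cases3)
  then show "z \<in> ?S"
    using z hull_abs_density hull_norm_velocity hull_norm_product_defect
      hull_norm_outer[of \<rho> u m \<gamma> 1] hull_norm_outer[of \<rho> u m \<gamma> "- 1"] by auto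
next
  fix z assume z: "z \<in> ?S"
  obtain \<rho> u m where zeq: "z = (\<rho>, u, m)" by (metis prod_cases3)
  show "z \<in> ?H"
  proof (cases "\<bar>\<rho>\<bar> = 1")
    case True
    then have "\<rho>\<^sup>2 = 1" by (simp add: abs_square_eq_1)
    then have "m = (1/2 * \<rho>) *\<^sub>R u" "norm u \<le> \<gamma>"
      using z zeq assms by (auto intro: power2_le_imp_le)
    then have "z \<in> K_set \<gamma>" using zeq True by (simp add: K_set_def)
    then show ?thesis using subset_Lambda_hull by blast
  next
    case False
    then show ?thesis
      using z inequalities_in_hull[OF assms] zeq by auto
  qed
qed

end
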